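(* Let $X$ be a Banach space and let $\mu \in \mathcal{M}$. Then $(PAP(\mathbb{R},X,\mu), \Vert \cdot \Vert_{\infty})$ is a Banach space.
   Context: $\mathcal{B}$ denotes the Lebesgue $\sigma$-field of $\mathbb{R}$ and $\mathcal{M}$ the set of all positive measures $\mu$ on $\mathcal{B}$ satisfying $\mu(\mathbb{R}) = +\infty$ and $\mu([a,b]) < +\infty$ for all $a,b \in \mathbb{R}$ with $a \leq b$. $BC(\mathbb{R},X)$ is the Banach space of all continuous bounded functions from $\mathbb{R}$ to $X$, with norm $\Vert f \Vert_{\infty} = \sup_{t \in \mathbb{R}} \Vert f(t) \Vert$. A continuous function $f : \mathbb{R} \to X$ is almost periodic (in the Bohr sense) if for all $\varepsilon > 0$ there exists $\ell > 0$ such that for all $\alpha \in \mathbb{R}$ there exists $\tau \in [\alpha, \alpha+\ell]$ with $\sup_{t \in \mathbb{R}} \Vert f(t+\tau) - f(t) \Vert < \varepsilon$. $AP(\mathbb{R},X)$ denotes the space of all such functions (which are bounded). For $\mu \in \mathcal{M}$, a function $f \in BC(\mathbb{R},X)$ is $\mu$-ergodic if $\lim_{r \to +\infty} \frac{1}{\mu([-r,r])} \int_{[-r,r]} \Vert f(t) \Vert \, d\mu(t) = 0$. $\mathcal{E}(\mathbb{R},X,\mu)$ denotes the space of all such functions. A function $f \in BC(\mathbb{R},X)$ is $\mu$-pseudo almost periodic if $f = g + \phi$ with $g \in AP(\mathbb{R},X)$ and $\phi \in \mathcal{E}(\mathbb{R},X,\mu)$. $PAP(\mathbb{R},X,\mu)$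 denotes the space of all such functions (the sum is not direct in general). *)

theory Defs
  imports "HOL-Analysis.Analysis"
begin

text \<open>
  The space of bounded continuous functions on the real line with the supremum norm is the
  library type \<open>real \<Rightarrow>\<^sub>C 'a\<close>; its elements are applied via \<open>apply_bcontfun\<close> (a coercion).
\<close>

definition admissible_measures :: "real measure set" where
  "admissible_measures = {\<mu>. sets \<mu> = sets (lebesgue :: real measure) \<and>
     emeasure \<mu> UNIV = \<infinity> \<and> (\<forall>a b. a \<le> b \<longrightarrow> emeasure \<mu> {a..b} < \<infinity>)}"

text \<open>
  The supremum is taken in the extended reals: boundedness of an almost periodic function is
  not part of the definition, and the supremum of an unbounded set of reals is unspecified.
\<close>

definition almost_periodic :: "(real \<Rightarrow> 'a::real_normed_vector) \<Rightarrow> bool" where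
  "almost_periodic f \<longleftrightarrow> continuous_on UNIV f \<and>
     (\<forall>\<epsilon>::real. \<epsilon> > 0 \<longrightarrow> (\<exists>l::real. l > 0 \<and> (\<forall>\<alpha>::real. \<exists>\<tau>\<in>{\<alpha>..\<alpha> + l}.
        (SUP t. ereal (norm (f (t + \<tau>) - f t))) < ereal \<epsilon>)))"

definition AP :: "(real \<Rightarrow> 'a::real_normed_vector) set" where
  "AP = {f. almost_periodic f}"

definition ergodic :: "real measure \<Rightarrow> (real \<Rightarrow>\<^sub>C 'a::real_normed_vector) set" where
  "ergodic \<mu> = {f. ((\<lambda>r. 1 / measure \<mu> {-r..r} *
     (LINT t:{-r..r}|\<mu>. norm (apply_bcontfun f t))) \<longlongrightarrow> 0) at_top}"

definition PAP :: "real measure \<Rightarrow> (real \<Rightarrow>\<^sub>C 'a::real_normed_vector) set" where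
  "PAP \<mu> = {f. \<exists>g\<in>AP. \<exists>\<phi>\<in>ergodic \<mu>.
     \<forall>t. apply_bcontfun f t = g t + apply_bcontfun \<phi> t}"

end

theory Submission
  imports Defs
begin

text \<open>
  The sum of two closed subspaces need not be closed, and here it need not be direct. What saves
  the situation is a truncation argument: if \<open>g\<close> is almost periodic, \<open>\<phi>\<close> is ergodic and
  \<open>\<parallel>g + \<phi>\<parallel> \<le> c\<close>, then the radial retraction \<open>h\<close> of \<open>g\<close> onto the ball of radius \<open>c\<close> is again
  almost periodic, and \<open>\<parallel>g t - h t\<parallel> \<le> \<parallel>\<phi> t\<parallel>\<close> pointwise, so \<open>g - h\<close> is ergodic.
  Hence a small element of the sum has a decomposition into small summands, and a
  telescoping series shows that the sum is closed.
\<close>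

section \<open>Sums of closed subspaces\<close>

text \<open>The hypothesis \<open>split\<close> replaces the S-part of a small sum by an element of
  norm at most \<open>c\<close>, at the cost of an element of T only. Applied to the differences of
  successive approximants of a limit point, it turns uncontrolled S-parts into a convergent series;
  the remainders lie in T and converge as well.\<close>

lemma closed_subspace_sum:
  fixes S T :: "'a::banach set"
  assumes S: "subspace S" "closed S" and T: "subspace T" "closed T"
    and split: "\<And>g \<phi> c. g \<in> S \<Longrightarrow> \<phi> \<in> T \<Longrightarrow> 0 < c \<Longrightarrow> norm (g + \<phi>) \<le> c \<Longrightarrow>
      \<exists>h\<in>S. norm h \<le> c \<and> g - h \<in> T"
  shows "closed {x + y |x y. x \<in> S \<and> y \<in> T}"
  unfolding closure_subset_eq[symmetric] subset_iff closure_approachable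
proof (intro allI impI)
  fix f assume f: "\<forall>e>0. \<exists>y\<in>{x + y |x y. x \<in> S \<and> y \<in> T}. dist y f < e"
  have "\<exists>x y. x \<in> S \<and> y \<in> T \<and> dist (x + y) f < (1 / 2) ^ n" for n :: nat
  proof -
    have "(1 / 2 :: real) ^ n > 0" by simp
    then show ?thesis using f by blast
  qed
  then obtain g \<phi> where g: "\<And>n. g n \<in> S" and \<phi>: "\<And>n. \<phi> n \<in> T"
    and near: "\<And>n. dist (g n + \<phi> n) f < (1 / 2) ^ n"
    by metis
  \<comment> \<open>Successive approximants are at most \<open>(1 / 2) ^ Suc n + (1 / 2) ^ n\<close>
    apart, which is rounded up to a summable geometric bound.\<close>
  have "\<exists>h\<in>S. norm h \<le> 2 * (1 / 2) ^ n \<and> (g (Suc n) - g n) - h \<in> T" for n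
  proof (rule split)
    show "g (Suc n) - g n \<in> S" "\<phi> (Suc n) - \<phi> n \<in> T"
      using g \<phi> S T by (auto intro: subspace_diff)
    have "norm ((g (Suc n) - g n) + (\<phi> (Suc n) - \<phi> n)) =
        dist (g (Suc n) + \<phi> (Suc n)) (g n + \<phi> n)"
      by (simp add: dist_norm algebra_simps)
    also have "\<dots> \<le> dist (g (Suc n) + \<phi> (Suc n)) f + dist (g n + \<phi> n) f"
      by (rule dist_triangle2)
    also have "\<dots> \<le> (1 / 2) ^ Suc n + (1 / 2) ^ n"
      using near by (intro add_mono less_imp_le)
    also have "\<dots> \<le> 2 * (1 / 2) ^ n" by simp
    finally show "norm ((g (Suc n) - g n) + (\<phi> (Suc n) - \<phi> n)) \<le> 2 * (1 / 2) ^ n" .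
  qed simp
  then obtain h where h: "\<And>n. h n \<in> S" and h_le: "\<And>n. norm (h n) \<le> 2 * (1 / 2) ^ n"
    and gh: "\<And>n. (g (Suc n) - g n) - h n \<in> T"
    by metis
  have "summable (\<lambda>n. 2 * (1 / 2 :: real) ^ n)"
    by (intro summable_mult summable_geometric) simp
  then have "summable h"
    by (rule summable_comparison_test'[where N = 0]) (use h_le in auto)
  \<comment> \<open>\<open>G n\<close> differs from \<open>g n\<close> by an element of T, but
    unlike \<open>g n\<close> it is known to converge.\<close>
  define G where "G n = g 0 + (\<Sum>k<n. h k)" for n
  have G_lim: "G \<longlonglongrightarrow> g 0 + suminf h"
    unfolding G_def by (intro tendsto_add tendsto_const summable_LIMSEQ \<open>summable h\<close>)
  have "G n \<in> S" for n
    unfolding G_def using g h S by (auto intro!: subspace_add subspace_sum)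
  then have GS: "g 0 + suminf h \<in> S"
    by (rule closed_sequentially[OF \<open>closed S\<close> _ G_lim])
  have rest: "g n + \<phi> n - G n \<in> T" for n
  proof (induction n)
    case 0
    then show ?case using \<phi> by (simp add: G_def)
  next
    case (Suc n)
    have "g (Suc n) + \<phi> (Suc n) - G (Suc n) =
        (g n + \<phi> n - G n) + ((\<phi> (Suc n) - \<phi> n) + ((g (Suc n) - g n) - h n))"
      by (simp add: G_def)
    also have "\<dots> \<in> T"
      by (rule subspace_add[OF T(1) Suc subspace_add[OF T(1) subspace_diff[OF T(1) \<phi> \<phi>] gh]])
    finally show ?case .
  qed
  have "(\<lambda>n. g n + \<phi> n) \<longlonglongrightarrow> f"
  proof (rule metric_LIMSEQ_I)
    fix r :: real assume "0 < r"
    then obtain N where N: "(1 / 2) ^ N < r"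
      using real_arch_pow_inv[of r "1 / 2"] by auto
    have "dist (g n + \<phi> n) f < r" if "n \<ge> N" for n
    proof -
      have "(1 / 2 :: real) ^ n \<le> (1 / 2) ^ N"
        using that by (intro power_decreasing) auto
      with near[of n] N show ?thesis by linarith
    qed
    then show "\<exists>no. \<forall>n\<ge>no. dist (g n + \<phi> n) f < r" by blast
  qed
  then have "(\<lambda>n. g n + \<phi> n - G n) \<longlonglongrightarrow> f - (g 0 + suminf h)"
    using G_lim by (rule tendsto_diff)
  then have "f - (g 0 + suminf h) \<in> T"
    by (rule closed_sequentially[OF \<open>closed T\<close> rest])
  moreover have "f = (g 0 + suminf h) + (f - (g 0 + suminf h))" by simp
  ultimately show "f \<in> {x + y |x y. x \<in> S \<and> y \<in> T}"
    using GS by blast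
qed

section \<open>The radial retraction onto a ball\<close>

text \<open>Writing the scaling factor with \<open>max\<close> covers the inside and the outside of
  the ball at once, and for c > 0 the denominator never vanishes, so continuity is
  immediate.\<close>

definition truncate :: "real \<Rightarrow> 'a::real_normed_vector \<Rightarrow> 'a" where
  "truncate c x = (c / max c (norm x)) *\<^sub>R x"

lemma norm_truncate_le:
  assumes "c > 0"
  shows "norm (truncate c x) \<le> c"
proof -
  have "norm (truncate c x) = c * (norm x / max c (norm x))"
    using assms by (simp add: truncate_def)
  also have "\<dots> \<le> c * 1"
    using assms by (intro mult_left_mono) (auto simp: divide_le_eq_1)
  finally show ?thesis by simp
qed

text \<open>Outside the ball the point x moves by exactly \<open>norm x - c\<close>, and
  \<open>norm x\<close> is at most \<open>norm (x + y) + norm y\<close>, hence at most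
  \<open>c + norm y\<close>.\<close>

lemma norm_diff_truncate_le:
  assumes "c > 0" "norm (x + y) \<le> c"
  shows "norm (x - truncate c x) \<le> norm y"
proof (cases "norm x \<le> c")
  case True
  then show ?thesis using assms by (simp add: truncate_def)
next
  case False
  then have "max c (norm x) = norm x" by simp
  then have "x - truncate c x = (1 - c / norm x) *\<^sub>R x"
    by (simp add: truncate_def scaleR_diff_left)
  moreover have "norm ((1 - c / norm x) *\<^sub>R x) = \<bar>1 - c / norm x\<bar> * norm x"
    by simp
  moreover have "1 - c / norm x \<ge> 0" using False assms by (simp add: divide_le_eq)
  moreover have "(1 - c / norm x) * norm x = norm x - c"
    using False assms by (cases "x = 0") (auto simp: left_diff_distrib)
  moreover have "norm x \<le> norm (x + y) + norm y"
    using norm_triangle_ineq4[of "x + y" y] by simp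
  ultimately show ?thesis using assms by simp
qed

text \<open>The difference splits into a change of the point with the scaling factor fixed and a
  change of the factor at y. Each contributes at most \<open>norm (x - y)\<close>, which gives the
  constant 2 in every normed space.\<close>

lemma norm_truncate_diff_le:
  assumes "c > 0"
  shows "norm (truncate c x - truncate c y) \<le> 2 * norm (x - y)"
proof -
  define m n where "m = max c (norm x)" and "n = max c (norm y)"
  \<comment> \<open>The last bound combines the reverse triangle inequality with the fact that
    taking the maximum with c is 1-Lipschitz.\<close>
  have mn: "c \<le> m" "c \<le> n" "norm y \<le> n" "\<bar>n - m\<bar> \<le> norm (x - y)"
    using norm_triangle_ineq3[of x y] by (auto simp: m_def n_def max_def)
  have "truncate c x - truncate c y = (c / m) *\<^sub>R (x - y) + (c / m - c / n) *\<^sub>R y"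
    by (simp add: truncate_def m_def n_def algebra_simps)
  then have "norm (truncate c x - truncate c y) \<le>
      \<bar>c / m\<bar> * norm (x - y) + \<bar>c / m - c / n\<bar> * norm y"
    by (metis norm_scaleR norm_triangle_ineq)
  also have "\<bar>c / m - c / n\<bar> * norm y = (c / m) * (norm y / n) * \<bar>n - m\<bar>"
  proof -
    have "c / m - c / n = (c / m) * (n - m) / n"
      using assms mn by (simp add: field_simps)
    then show ?thesis using assms mn by (simp add: abs_mult)
  qed
  also have "\<dots> \<le> 1 * 1 * norm (x - y)"
    using assms mn by (intro mult_mono) auto
  also have "\<bar>c / m\<bar> * norm (x - y) \<le> 1 * norm (x - y)"
    using assms mn by (intro mult_right_mono) auto
  finally show ?thesis by simp
qed

lemma continuous_on_truncate:
  assumes "c > 0" "continuous_on A f"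
  shows "continuous_on A (\<lambda>t. truncate c (f t))"
  unfolding truncate_def using assms by (intro continuous_intros) auto

section \<open>Almost periodic functions\<close>

lemma norm_diff_le_three:
  assumes "norm (x' - y') \<le> a" "norm (x' - x) \<le> b" "norm (y' - y) \<le> c"
  shows "norm (x - y) \<le> a + b + c"
proof -
  have "x - y = ((x' - y') - (x' - x)) + (y' - y)" by simp
  then have "norm (x - y) \<le> norm ((x' - y') - (x' - x)) + norm (y' - y)"
    by (metis norm_triangle_ineq)
  also have "\<dots> \<le> norm (x' - y') + norm (x' - x) + norm (y' - y)"
    by (intro add_right_mono norm_triangle_ineq4)
  finally show ?thesis using assms by simp
qed

lemma SUP_ereal_less_imp_le:
  assumes "(SUP t. ereal (u t)) < ereal e"
  shows "u t \<le> e"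
proof -
  have "ereal (u t) \<le> (SUP t. ereal (u t))" by (rule SUP_upper) simp
  also note assms
  finally show ?thesis by simp
qed

text \<open>As \<epsilon> is arbitrary, the strict bound on the extended real supremum can be traded
  for a non-strict pointwise bound; halving \<epsilon> recovers strictness.\<close>

lemma almost_periodic_iff:
  "almost_periodic f \<longleftrightarrow> continuous_on UNIV f \<and>
     (\<forall>e>0. \<exists>l>0. \<forall>a. \<exists>\<tau>\<in>{a..a + l}. \<forall>t. norm (f (t + \<tau>) - f t) \<le> e)"
    (is "_ \<longleftrightarrow> _ \<and> (\<forall>e>0. ?P e)")
proof -
  let ?Q = "\<lambda>e. \<exists>l>0. \<forall>a. \<exists>\<tau>\<in>{a..a + l}. (SUP t. ereal (norm (f (t + \<tau>) - f t))) < ereal e"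
  have P: "?P e" if "?Q e" for e
  proof -
    have "\<forall>t. norm (f (t + \<tau>) - f t) \<le> e"
      if "(SUP t. ereal (norm (f (t + \<tau>) - f t))) < ereal e" for \<tau>
      by (intro allI SUP_ereal_less_imp_le[OF that])
    with that show ?thesis by meson
  qed
  have Q: "?Q e" if e: "e > 0" and P: "?P (e / 2)" for e
  proof -
    have "(SUP t. ereal (norm (f (t + \<tau>) - f t))) < ereal e"
      if "\<forall>t. norm (f (t + \<tau>) - f t) \<le> e / 2" for \<tau>
    proof -
      have "(SUP t. ereal (norm (f (t + \<tau>) - f t))) \<le> ereal (e / 2)"
        using that by (intro SUP_least) simp
      also have "\<dots> < ereal e" using e by simp
      finally show ?thesis .
    qed
    with P show ?thesis by meson
  qed
  have "(\<forall>e>0. ?Q e) \<longleftrightarrow> (\<forall>e>0. ?P e)"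
  proof (intro iffI allI impI)
    fix e :: real assume "\<forall>e>0. ?Q e" "e > 0"
    then show "?P e" by (intro P) simp
  next
    fix e :: real assume "\<forall>e>0. ?P e" "e > 0"
    then show "?Q e" using Q[of e] half_gt_zero[of e] by blast
  qed
  then show ?thesis
    unfolding almost_periodic_def by simp
qed

text \<open>A common almost period carries two nearby points into a fixed compact interval, where
  continuity is uniform; going there and back costs e / 3 at each point.\<close>

lemma almost_periodic_imp_uniformly_continuous:
  assumes "almost_periodic f" "e > 0"
  shows "\<exists>d>0. \<forall>s t. \<bar>s - t\<bar> < d \<longrightarrow> norm (f s - f t) \<le> e"
proof -
  have e3: "e / 3 > 0" using assms by simp
  then obtain l where "l > 0" and
    l: "\<And>a. \<exists>\<tau>\<in>{a..a + l}. \<forall>t. norm (f (t + \<tau>) - f t) \<le> e / 3"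
    using assms(1) unfolding almost_periodic_iff by meson
  \<comment> \<open>The margin 1 on both sides makes room for t: s is shifted into the interval from
    0 to l, and t is less than 1 away from s.\<close>
  have "continuous_on {-1..l + 1} f"
    using assms(1) by (auto simp: almost_periodic_def intro: continuous_on_subset)
  then have "uniformly_continuous_on {-1..l + 1} f"
    by (simp add: compact_uniformly_continuous)
  then obtain d where "d > 0" and
    d: "\<And>x y. x \<in> {-1..l + 1} \<Longrightarrow> y \<in> {-1..l + 1} \<Longrightarrow> dist y x < d \<Longrightarrow> dist (f y) (f x) < e / 3"
    unfolding uniformly_continuous_on_def using e3 by meson
  have "norm (f s - f t) \<le> e" if st: "\<bar>s - t\<bar> < min d 1" for s t
  proof -
    obtain \<tau> where "\<tau> \<in> {- s..- s + l}" and \<tau>: "\<And>t. norm (f (t + \<tau>) - f t) \<le> e / 3"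
      using l by blast
    then have "dist (f (s + \<tau>)) (f (t + \<tau>)) < e / 3"
      using st by (intro d) (auto simp: dist_real_def)
    then have "norm (f (s + \<tau>) - f (t + \<tau>)) \<le> e / 3" by (simp add: dist_norm)
    from norm_diff_le_three[OF this \<tau>[of s] \<tau>[of t]] show ?thesis by simp
  qed
  then show ?thesis using \<open>d > 0\<close> by (intro exI[of _ "min d 1"]) auto
qed

text \<open>
  Bochner's criterion, with total boundedness of the set of translates phrased as a finite
  colouring of the shifts; colourings of two functions are easily combined, unlike their almost
  periods.
\<close>

lemma almost_periodic_finite_colouring:
  assumes "almost_periodic f" "e > 0"
  shows "\<exists>c :: real \<Rightarrow> nat. finite (range c) \<and>
    (\<forall>a b. c a = c b \<longrightarrow> (\<forall>t. norm (f (t + a) - f (t + b)) \<le> e))"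
proof -
  have e3: "e / 3 > 0" using assms by simp
  then obtain l where "l > 0" and
    l: "\<And>a. \<exists>\<tau>\<in>{a..a + l}. \<forall>t. norm (f (t + \<tau>) - f t) \<le> e / 3"
    using assms(1) unfolding almost_periodic_iff by meson
  obtain d where "d > 0" and d: "\<And>s t. \<bar>s - t\<bar> < d \<Longrightarrow> norm (f s - f t) \<le> e / 3"
    using almost_periodic_imp_uniformly_continuous[OF assms(1) e3] by blast
  \<comment> \<open>Every shift is moved into the interval from 0 to l by an almost period. The
    colour of a shift will be the cell of length d that contains the moved shift.\<close>
  have "\<exists>\<tau>. a + \<tau> \<in> {0..l} \<and> (\<forall>t. norm (f (t + \<tau>) - f t) \<le> e / 3)" for a
  proof -
    obtain \<tau> where "\<tau> \<in> {- a..- a + l}" "\<forall>t. norm (f (t + \<tau>) - f t) \<le> e / 3"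
      using l by blast
    then show ?thesis by (intro exI[of _ \<tau>]) auto
  qed
  then obtain \<tau> where \<tau>: "\<And>a. a + \<tau> a \<in> {0..l}"
    "\<And>a t. norm (f (t + \<tau> a) - f t) \<le> e / 3"
    by metis
  define c where "c a = nat \<lfloor>(a + \<tau> a) / d\<rfloor>" for a
  have "c a \<le> nat \<lfloor>l / d\<rfloor>" for a
    unfolding c_def using \<tau>(1)[of a] \<open>d > 0\<close>
    by (intro nat_mono floor_mono divide_right_mono) auto
  then have "finite (range c)"
    by (intro finite_subset[of "range c" "{..nat \<lfloor>l / d\<rfloor>}"]) auto
  moreover have "norm (f (t + a) - f (t + b)) \<le> e" if "c a = c b" for a b t
  proof -
    \<comment> \<open>Nonnegativity makes \<open>nat\<close> injective on these floors, so equal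
      colours mean the same cell.\<close>
    have nonneg: "(a + \<tau> a) / d \<ge> 0" "(b + \<tau> b) / d \<ge> 0"
      using \<tau>(1) \<open>d > 0\<close> by auto
    then have "\<lfloor>(a + \<tau> a) / d\<rfloor> = \<lfloor>(b + \<tau> b) / d\<rfloor>"
      using that unfolding c_def by (simp add: eq_nat_nat_iff)
    then have "\<bar>(a + \<tau> a) / d - (b + \<tau> b) / d\<bar> < 1"
      by linarith
    then have "\<bar>(t + a + \<tau> a) - (t + b + \<tau> b)\<bar> < d"
      using \<open>d > 0\<close> by (simp add: diff_divide_distrib[symmetric] add_ac)
    then have "norm (f (t + a + \<tau> a) - f (t + b + \<tau> b)) \<le> e / 3"
      by (rule d)
    from norm_diff_le_three[OF this \<tau>(2)[of "t + a" a] \<tau>(2)[of "t + b" b]]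
    show ?thesis by simp
  qed
  ultimately show ?thesis by blast
qed

text \<open>The difference of two shifts of the same colour is an almost period. Choosing one
  representative per colour gives a bounded set of representatives, so subtracting them from
  suitable shifts yields almost periods in every interval of a fixed length.\<close>

lemma finite_colouring_imp_almost_periodic:
  assumes cont: "continuous_on UNIV f"
    and colouring: "\<And>e. e > 0 \<Longrightarrow> \<exists>c :: real \<Rightarrow> nat. finite (range c) \<and>
      (\<forall>a b. c a = c b \<longrightarrow> (\<forall>t. norm (f (t + a) - f (t + b)) \<le> e))"
  shows "almost_periodic f"
  unfolding almost_periodic_iff
proof (intro conjI cont allI impI)
  fix e :: real assume "e > 0"
  then obtain c :: "real \<Rightarrow> nat" where "finite (range c)"
    and c: "\<And>a b t. c a = c b \<Longrightarrow> norm (f (t + a) - f (t + b)) \<le> e"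
    using colouring by meson
  from \<open>finite (range c)\<close> have "bounded (inv c ` range c)"
    by (rule finite_imp_bounded[OF finite_imageI])
  then obtain M where "M > 0" and M: "\<And>a. \<bar>inv c (c a)\<bar> \<le> M"
    unfolding bounded_pos by auto
  have "\<exists>\<tau>\<in>{\<alpha>..\<alpha> + 2 * M}. \<forall>t. norm (f (t + \<tau>) - f t) \<le> e" for \<alpha>
  proof -
    \<comment> \<open>Here a is the midpoint of the target interval and b the representative of its
      colour; since b has absolute value at most M, \<open>a - b\<close> stays in the
      interval.\<close>
    define a b where "a = \<alpha> + M" and "b = inv c (c a)"
    have "c a = c b" by (simp add: b_def f_inv_into_f)
    have "norm (f (t + (a - b)) - f t) \<le> e" for t
      using c[OF \<open>c a = c b\<close>, of "t - b"] by (simp add: algebra_simps)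
    moreover have "a - b \<in> {\<alpha>..\<alpha> + 2 * M}"
      using M[of a] unfolding a_def b_def by auto
    ultimately show ?thesis by blast
  qed
  then show "\<exists>l>0. \<forall>a. \<exists>\<tau>\<in>{a..a + l}. \<forall>t. norm (f (t + \<tau>) - f t) \<le> e"
    using \<open>M > 0\<close> by (intro exI[of _ "2 * M"]) auto
qed

text \<open>A single transfer principle for all closure properties: two dominating functions serve
  sums, the factor C serves scalar multiples, and the slack e, with f and g depending on it, serves
  uniform limits. A common refinement of the colourings of f and g colours h.\<close>

lemma almost_periodic_dominated:
  fixes h :: "real \<Rightarrow> 'a::real_normed_vector"
  assumes cont: "continuous_on UNIV h"
    and dom: "\<And>e. e > 0 \<Longrightarrow> \<exists>C. \<exists>(f :: real \<Rightarrow> 'a) (g :: real \<Rightarrow> 'a).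
      almost_periodic f \<and> almost_periodic g \<and>
      (\<forall>s t. norm (h s - h t) \<le> e + C * (norm (f s - f t) + norm (g s - g t)))"
  shows "almost_periodic h"
proof (rule finite_colouring_imp_almost_periodic[OF cont])
  fix e :: real assume e: "e > 0"
  obtain C and f g :: "real \<Rightarrow> 'a" where fg: "almost_periodic f" "almost_periodic g"
    and le: "\<And>s t. norm (h s - h t) \<le> e / 2 + C * (norm (f s - f t) + norm (g s - g t))"
    using dom[OF half_gt_zero[OF e]] by blast
  \<comment> \<open>Chosen so that \<open>(\<bar>C\<bar> + 1) * (d + d)\<close> equals e / 2;
    \<open>\<bar>C\<bar> + 1\<close> replaces C, which may be zero or negative.\<close>
  define d where "d = e / (4 * (\<bar>C\<bar> + 1))"
  have "d > 0" using e by (simp add: d_def)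
  obtain c :: "real \<Rightarrow> nat" where "finite (range c)"
    and c: "\<And>a b t. c a = c b \<Longrightarrow> norm (f (t + a) - f (t + b)) \<le> d"
    using almost_periodic_finite_colouring[OF fg(1) \<open>d > 0\<close>] by blast
  obtain c' :: "real \<Rightarrow> nat" where "finite (range c')"
    and c': "\<And>a b t. c' a = c' b \<Longrightarrow> norm (g (t + a) - g (t + b)) \<le> d"
    using almost_periodic_finite_colouring[OF fg(2) \<open>d > 0\<close>] by blast
  have "range (\<lambda>a. prod_encode (c a, c' a)) \<subseteq> prod_encode ` (range c \<times> range c')"
    by auto
  then have "finite (range (\<lambda>a. prod_encode (c a, c' a)))"
    using \<open>finite (range c)\<close> \<open>finite (range c')\<close> finite_subset by blast
  moreover have "norm (h (t + a) - h (t + b)) \<le> e"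
    if eq: "prod_encode (c a, c' a) = prod_encode (c b, c' b)" for a b t
  proof -
    let ?D = "norm (f (t + a) - f (t + b)) + norm (g (t + a) - g (t + b))"
    have "C * ?D \<le> (\<bar>C\<bar> + 1) * ?D"
      by (intro mult_right_mono) auto
    also have "\<dots> \<le> (\<bar>C\<bar> + 1) * (d + d)"
      using c[of a b t] c'[of a b t] eq by (intro mult_left_mono add_mono) auto
    also have "\<dots> = (4 * (\<bar>C\<bar> + 1)) * d / 2"
      by simp
    also have "\<dots> = e / 2"
      unfolding d_def by simp
    finally show ?thesis
      using le[of "t + a" "t + b"] by simp
  qed
  ultimately show "\<exists>c :: real \<Rightarrow> nat. finite (range c) \<and>
      (\<forall>a b. c a = c b \<longrightarrow> (\<forall>t. norm (h (t + a) - h (t + b)) \<le> e))"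
    by blast
qed

lemma almost_periodic_const: "almost_periodic (\<lambda>_. x)"
  by (rule finite_colouring_imp_almost_periodic) (auto intro!: exI[of _ "\<lambda>_. 0"])

lemma almost_periodic_dominated2:
  fixes f g h :: "real \<Rightarrow> 'a::real_normed_vector"
  assumes "continuous_on UNIV h" "almost_periodic f" "almost_periodic g"
    and "\<And>s t. norm (h s - h t) \<le> C * (norm (f s - f t) + norm (g s - g t))"
  shows "almost_periodic h"
  using assms(1)
proof (rule almost_periodic_dominated)
  fix e :: real assume "e > 0"
  then have "norm (h s - h t) \<le> e + C * (norm (f s - f t) + norm (g s - g t))" for s t
    using assms(4)[of s t] by simp
  then show "\<exists>C. \<exists>(f :: real \<Rightarrow> 'a) (g :: real \<Rightarrow> 'a).
      almost_periodic f \<and> almost_periodic g \<and>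
      (\<forall>s t. norm (h s - h t) \<le> e + C * (norm (f s - f t) + norm (g s - g t)))"
    using assms(2,3) by blast
qed

section \<open>Almost periodic functions as a closed subspace of the bounded continuous
  functions\<close>

definition AP_bcontfun :: "(real \<Rightarrow>\<^sub>C 'a::real_normed_vector) set" where
  "AP_bcontfun = {f. almost_periodic (apply_bcontfun f)}"

lemma subspace_AP_bcontfun: "subspace AP_bcontfun"
proof (rule subspaceI)
  show "0 \<in> AP_bcontfun"
    using almost_periodic_const[of 0] by (simp add: AP_bcontfun_def zero_bcontfun.rep_eq)
next
  fix f g :: "real \<Rightarrow>\<^sub>C 'a" assume "f \<in> AP_bcontfun" "g \<in> AP_bcontfun"
  then show "f + g \<in> AP_bcontfun"
    unfolding AP_bcontfun_def mem_Collect_eq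
    by (rule almost_periodic_dominated2[where C = 1, OF continuous_on_apply_bcontfun])
      (simp add: norm_diff_triangle_ineq)
next
  fix c :: real and f :: "real \<Rightarrow>\<^sub>C 'a" assume f: "f \<in> AP_bcontfun"
  have dom: "norm ((c *\<^sub>R f) s - (c *\<^sub>R f) t) \<le> \<bar>c\<bar> * (norm (f s - f t) + norm (f s - f t))" for s t
  proof -
    have "norm ((c *\<^sub>R f) s - (c *\<^sub>R f) t) = \<bar>c\<bar> * norm (f s - f t)"
      by (simp flip: scaleR_diff_right)
    also have "\<dots> \<le> \<bar>c\<bar> * (norm (f s - f t) + norm (f s - f t))"
      by (intro mult_left_mono) auto
    finally show ?thesis .
  qed
  show "c *\<^sub>R f \<in> AP_bcontfun"
    using f almost_periodic_dominated2[OF continuous_on_apply_bcontfun _ _ dom]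
    by (simp add: AP_bcontfun_def)
qed

lemma closed_AP_bcontfun: "closed AP_bcontfun"
  unfolding closure_subset_eq[symmetric] subset_iff closure_approachable
proof (intro allI impI)
  fix h :: "real \<Rightarrow>\<^sub>C 'a" assume lim: "\<forall>e>0. \<exists>f\<in>AP_bcontfun. dist f h < e"
  show "h \<in> AP_bcontfun"
    unfolding AP_bcontfun_def mem_Collect_eq
  proof (rule almost_periodic_dominated[OF continuous_on_apply_bcontfun])
    fix e :: real assume "e > 0"
    then obtain f where f: "f \<in> AP_bcontfun" "dist f h < e / 2"
      using lim[rule_format, of "e / 2"] by auto
    \<comment> \<open>Replacing h by f costs e / 2 at each of s and t. The function f fills both
      places of the dominating pair.\<close>
    have "norm (h s - h t) \<le> e + 1 * (norm (f s - f t) + norm (f s - f t))" for s t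
    proof -
      have near: "norm (f u - h u) \<le> e / 2" for u
        using dist_fun_lt_imp_dist_val_lt[OF f(2), of u] by (simp add: dist_norm)
      from norm_diff_le_three[OF order_refl near[of s] near[of t]]
      have "norm (h s - h t) \<le> norm (f s - f t) + e" by simp
      also have "\<dots> \<le> (norm (f s - f t) + norm (f s - f t)) + e"
        by simp
      finally show ?thesis by (simp add: add.commute)
    qed
    then show "\<exists>C. \<exists>(f :: real \<Rightarrow> 'a) (g :: real \<Rightarrow> 'a).
      almost_periodic f \<and> almost_periodic g \<and>
        (\<forall>s t. norm (h s - h t) \<le> e + C * (norm (f s - f t) + norm (g s - g t)))"
      using f(1) unfolding AP_bcontfun_def mem_Collect_eq
      by blast
  qed
qed

section \<open>Ergodic functions\<close>

definition mean_norm ::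
    "real measure \<Rightarrow> (real \<Rightarrow>\<^sub>C 'a::real_normed_vector) \<Rightarrow> real \<Rightarrow> real" where
  "mean_norm \<mu> f r = 1 / measure \<mu> {-r..r} * (LINT t:{-r..r}|\<mu>. norm (f t))"

lemma ergodic_iff: "f \<in> ergodic \<mu> \<longleftrightarrow> (mean_norm \<mu> f \<longlongrightarrow> 0) at_top"
  by (simp add: ergodic_def mean_norm_def[abs_def])

context
  fixes \<mu> :: "real measure"
  assumes \<mu>: "\<mu> \<in> admissible_measures"
begin

lemma emeasure_Icc_finite: "emeasure \<mu> {a..b} < \<infinity>"
  using \<mu> by (cases "a \<le> b") (auto simp: admissible_measures_def)

lemma Icc_in_sets: "{a..b} \<in> sets \<mu>"
  using \<mu> by (auto simp: admissible_measures_def)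

text \<open>Continuous functions are Borel, hence Lebesgue measurable, and \<mu> lives on the
  Lebesgue sets; on a compact interval they are bounded, and the interval has finite
  measure.\<close>

lemma set_integrable_Icc:
  fixes u :: "real \<Rightarrow> real"
  assumes "continuous_on UNIV u"
  shows "set_integrable \<mu> {a..b} u"
proof -
  have "u \<in> borel_measurable borel"
    by (rule borel_measurable_continuous_onI[OF assms])
  then have "u \<in> borel_measurable lborel" by simp
  then have "u \<in> borel_measurable lebesgue"
    by (rule measurable_completion)
  also have "borel_measurable (lebesgue :: real measure) = borel_measurable \<mu>"
    using \<mu> by (intro measurable_cong_sets) (auto simp: admissible_measures_def)
  finally have u: "u \<in> borel_measurable \<mu>" .
  have "bounded (u ` {a..b})"
    by (intro compact_imp_bounded compact_continuous_image continuous_on_subset[OF assms]) auto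
  then obtain B where "\<And>x. x \<in> {a..b} \<Longrightarrow> norm (u x) \<le> B"
    unfolding bounded_iff by blast
  then show ?thesis
    unfolding set_integrable_def
    by (intro integrableI_bounded_set_indicator[where B = B] Icc_in_sets u emeasure_Icc_finite) auto
qed

lemma mean_norm_nonneg: "0 \<le> mean_norm \<mu> f r"
  unfolding mean_norm_def set_lebesgue_integral_def
  by (intro mult_nonneg_nonneg integral_nonneg_AE) auto

text \<open>If \<open>{-r..r}\<close> is a null set, both means are \<open>0\<close> because \<open>1 / 0 = 0\<close>.\<close>

lemma mean_norm_dominated:
  fixes f :: "real \<Rightarrow>\<^sub>C 'a::real_normed_vector" and g :: "real \<Rightarrow>\<^sub>C 'b::real_normed_vector"
    and h :: "real \<Rightarrow>\<^sub>C 'c::real_normed_vector"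
  assumes "e \<ge> 0"
    and dom: "\<And>t. norm (f t) \<le> e + C * (norm (g t) + norm (h t))"
  shows "mean_norm \<mu> f r \<le> e + C * (mean_norm \<mu> g r + mean_norm \<mu> h r)"
proof -
  let ?I = "{-r..r}"
  note int = set_integrable_Icc[of _ "-r" r]
  have "(LINT t:?I|\<mu>. norm (f t)) \<le> (LINT t:?I|\<mu>. e + C * (norm (g t) + norm (h t)))"
    by (intro set_integral_mono int dom continuous_intros) auto
  also have "\<dots> = (LINT t:?I|\<mu>. e) + (LINT t:?I|\<mu>. C * (norm (g t) + norm (h t)))"
    by (intro set_integral_add int continuous_intros) auto
  also have "(LINT t:?I|\<mu>. e) = measure \<mu> ?I * e"
    using emeasure_Icc_finite[of "-r" r] by (subst set_integral_const) (auto intro: Icc_in_sets)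
  also have "(LINT t:?I|\<mu>. C * (norm (g t) + norm (h t))) =
      C * ((LINT t:?I|\<mu>. norm (g t)) + (LINT t:?I|\<mu>. norm (h t)))"
    by (subst set_integral_mult_right, subst set_integral_add(2))
      (auto intro!: int continuous_intros)
  finally have "mean_norm \<mu> f r \<le> 1 / measure \<mu> ?I *
      (measure \<mu> ?I * e + C * ((LINT t:?I|\<mu>. norm (g t)) + (LINT t:?I|\<mu>. norm (h t))))"
    unfolding mean_norm_def by (intro mult_left_mono) auto
  also have "\<dots> = 1 / measure \<mu> ?I * measure \<mu> ?I * e + C * (mean_norm \<mu> g r + mean_norm \<mu> h r)"
    by (simp add: mean_norm_def algebra_simps add_divide_distrib)
  \<comment> \<open>The factor in front of e is 1, or 0 for a null interval; this is where
    \<open>e \<ge> 0\<close> enters.\<close>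
  also have "1 / measure \<mu> ?I * measure \<mu> ?I * e \<le> e"
    using \<open>e \<ge> 0\<close> by simp
  finally show ?thesis by simp
qed

text \<open>The counterpart of \<open>almost_periodic_dominated\<close>: domination passes to the
  means, whose upper bound tends to the slack, and the slack is arbitrary.\<close>

lemma ergodic_dominated:
  fixes f :: "real \<Rightarrow>\<^sub>C 'a::real_normed_vector"
  assumes dom: "\<And>e. e > 0 \<Longrightarrow> \<exists>C. \<exists>g\<in>ergodic \<mu> :: (real \<Rightarrow>\<^sub>C 'a) set.
      \<exists>h\<in>ergodic \<mu> :: (real \<Rightarrow>\<^sub>C 'a) set. \<forall>t. norm (f t) \<le> e + C * (norm (g t) + norm (h t))"
  shows "f \<in> ergodic \<mu>"
  unfolding ergodic_iff
proof (rule tendstoI)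
  fix e :: real assume e: "e > 0"
  obtain C and g h :: "real \<Rightarrow>\<^sub>C 'a" where gh: "g \<in> ergodic \<mu>" "h \<in> ergodic \<mu>"
    and le: "\<And>t. norm (f t) \<le> e / 2 + C * (norm (g t) + norm (h t))"
    using dom[OF half_gt_zero[OF e]] by blast
  have "((\<lambda>r. e / 2 + C * (mean_norm \<mu> g r + mean_norm \<mu> h r)) \<longlongrightarrow> e / 2 + C * (0 + 0)) at_top"
    using gh unfolding ergodic_iff by (intro tendsto_intros)
  then have "\<forall>\<^sub>F r in at_top. e / 2 + C * (mean_norm \<mu> g r + mean_norm \<mu> h r) < e"
    by (rule order_tendstoD) (use e in simp)
  then show "\<forall>\<^sub>F r in at_top. dist (mean_norm \<mu> f r) 0 < e"
  proof eventually_elim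
    case (elim r)
    have "mean_norm \<mu> f r \<le> e / 2 + C * (mean_norm \<mu> g r + mean_norm \<mu> h r)"
      using e le by (intro mean_norm_dominated) auto
    with elim show ?case
      using mean_norm_nonneg[of f r] by (simp add: dist_real_def)
  qed
qed

lemma ergodic_dominated2:
  fixes f :: "real \<Rightarrow>\<^sub>C 'a::real_normed_vector" and g h :: "real \<Rightarrow>\<^sub>C 'a"
  assumes "g \<in> ergodic \<mu>" "h \<in> ergodic \<mu>"
    and le: "\<And>t. norm (f t) \<le> C * (norm (g t) + norm (h t))"
  shows "f \<in> ergodic \<mu>"
proof (rule ergodic_dominated)
  fix e :: real assume "e > 0"
  then have "norm (f t) \<le> e + C * (norm (g t) + norm (h t))" for t
    using le[of t] by simp
  then show "\<exists>C. \<exists>g\<in>ergodic \<mu> :: (real \<Rightarrow>\<^sub>C 'a) set.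
      \<exists>h\<in>ergodic \<mu> :: (real \<Rightarrow>\<^sub>C 'a) set. \<forall>t. norm (f t) \<le> e + C * (norm (g t) + norm (h t))"
    using assms(1,2) by blast
qed

lemma subspace_ergodic: "subspace (ergodic \<mu>)"
proof (rule subspaceI)
  show "0 \<in> ergodic \<mu>"
    by (simp add: ergodic_def set_lebesgue_integral_def)
next
  fix f g :: "real \<Rightarrow>\<^sub>C 'a" assume "f \<in> ergodic \<mu>" "g \<in> ergodic \<mu>"
  then show "f + g \<in> ergodic \<mu>"
    by (rule ergodic_dominated2[where C = 1]) (simp add: norm_triangle_ineq)
next
  fix c :: real and f :: "real \<Rightarrow>\<^sub>C 'a" assume f: "f \<in> ergodic \<mu>"
  show "c *\<^sub>R f \<in> ergodic \<mu>"
    by (rule ergodic_dominated2[where C = "\<bar>c\<bar>", OF f f]) (simp add: mult_left_mono)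
qed

lemma closed_ergodic: "closed (ergodic \<mu>)"
  unfolding closure_subset_eq[symmetric] subset_iff closure_approachable
proof (intro allI impI)
  fix f :: "real \<Rightarrow>\<^sub>C 'a" assume lim: "\<forall>e>0. \<exists>g\<in>ergodic \<mu>. dist g f < e"
  show "f \<in> ergodic \<mu>"
  proof (rule ergodic_dominated)
    fix e :: real assume "e > 0"
    then obtain g where g: "g \<in> ergodic \<mu>" "dist g f < e"
      using lim by blast
    have "norm (f t) \<le> e + 1 * (norm (g t) + norm (g t))" for t
    proof -
      have near: "norm (g t - f t) \<le> e"
        using dist_fun_lt_imp_dist_val_lt[OF g(2), of t] by (simp add: dist_norm)
      have "norm (f t) \<le> norm (g t) + norm (g t - f t)"
        using norm_triangle_ineq4[of "g t" "g t - f t"] by simp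
      also have "\<dots> \<le> (norm (g t) + norm (g t)) + e"
        using near by (intro add_mono) auto
      finally show ?thesis by (simp add: add.commute)
    qed
    then show "\<exists>C. \<exists>g\<in>ergodic \<mu> :: (real \<Rightarrow>\<^sub>C 'a) set.
        \<exists>h\<in>ergodic \<mu> :: (real \<Rightarrow>\<^sub>C 'a) set. \<forall>t. norm (f t) \<le> e + C * (norm (g t) + norm (h t))"
      using g(1) by blast
  qed
qed

text \<open>This supplies the hypothesis \<open>split\<close> of \<open>closed_subspace_sum\<close>,
  with h the pointwise truncation of g at radius c.\<close>

lemma small_decomposition:
  assumes g: "g \<in> AP_bcontfun" and \<phi>: "\<phi> \<in> ergodic \<mu>" and c: "c > 0" "norm (g + \<phi>) \<le> c"
  shows "\<exists>h\<in>AP_bcontfun. norm h \<le> c \<and> g - h \<in> ergodic \<mu>"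
proof -
  have "(\<lambda>t. truncate c (g t)) \<in> bcontfun"
    using c(1) by (intro bcontfun_normI[where b = c] continuous_on_truncate norm_truncate_le) auto
  then obtain h where "(\<lambda>t. truncate c (g t)) = apply_bcontfun h"
    by (rule bcontfunE)
  then have h: "h t = truncate c (g t)" for t
    by metis
  have "h \<in> AP_bcontfun"
    using g unfolding AP_bcontfun_def mem_Collect_eq
    by (intro almost_periodic_dominated2[where f = g and g = g and C = 1 and h = h]
        continuous_on_apply_bcontfun)
      \<comment> \<open>With g in both places and C = 1, the dominating expression is exactly the
        Lipschitz bound with constant 2.\<close>
      (use norm_truncate_diff_le[OF c(1)] in \<open>simp_all add: h\<close>)
  moreover have "norm h \<le> c"
    by (rule norm_bound) (simp add: h norm_truncate_le c(1))
  moreover have "g - h \<in> ergodic \<mu>"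
  proof (rule ergodic_dominated2[OF \<phi> \<phi>, where C = "1 / 2"])
    fix t
    have "norm (g t + \<phi> t) \<le> c"
      using norm_bounded[of "g + \<phi>" t] c(2) by simp
    then have "norm (g t - truncate c (g t)) \<le> norm (\<phi> t)"
      by (rule norm_diff_truncate_le[OF c(1)])
    then show "norm ((g - h) t) \<le> 1 / 2 * (norm (\<phi> t) + norm (\<phi> t))"
      by (simp add: h)
  qed
  ultimately show ?thesis by blast
qed

end

text \<open>
  Boundedness of the almost periodic part is automatic here, being a difference of two bounded
  functions.
\<close>

lemma PAP_eq_sum: "PAP \<mu> = {g + \<phi> |g \<phi>. g \<in> AP_bcontfun \<and> \<phi> \<in> ergodic \<mu>}"
proof (intro equalityI subsetI)
  fix f assume "f \<in> PAP \<mu>"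
  then obtain g \<phi> where g: "g \<in> AP" and \<phi>: "\<phi> \<in> ergodic \<mu>" and eq: "\<And>t. f t = g t + \<phi> t"
    unfolding PAP_def by blast
  have "g = apply_bcontfun (f - \<phi>)"
    by (simp add: fun_eq_iff eq)
  then have "f - \<phi> \<in> AP_bcontfun"
    using g by (simp add: AP_def AP_bcontfun_def)
  moreover have "f = (f - \<phi>) + \<phi>" by simp
  ultimately show "f \<in> {g + \<phi> |g \<phi>. g \<in> AP_bcontfun \<and> \<phi> \<in> ergodic \<mu>}"
    using \<phi> by blast
next
  fix f assume "f \<in> {g + \<phi> |g \<phi>. g \<in> AP_bcontfun \<and> \<phi> \<in> ergodic \<mu>}"
  then show "f \<in> PAP \<mu>"
    by (force simp: PAP_def AP_def AP_bcontfun_def)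
qed

text \<open>Joins the normed structure and the completeness of the supremum metric into the class
  \<open>banach\<close> that \<open>closed_subspace_sum\<close> asks for.\<close>

instance bcontfun :: (metric_space, banach) banach ..

theorem theorem5p5:
  fixes \<mu> :: "real measure"
  assumes "\<mu> \<in> admissible_measures"
  shows "subspace (PAP \<mu> :: (real \<Rightarrow>\<^sub>C 'a::banach) set) \<and>
    complete (PAP \<mu> :: (real \<Rightarrow>\<^sub>C 'a) set)"
proof
  show "subspace (PAP \<mu> :: (real \<Rightarrow>\<^sub>C 'a) set)"
    unfolding PAP_eq_sum
    by (rule subspace_sums[OF subspace_AP_bcontfun subspace_ergodic[OF assms]])
  have "closed (PAP \<mu> :: (real \<Rightarrow>\<^sub>C 'a) set)"
    unfolding PAP_eq_sum
    by (intro closed_subspace_sum subspace_AP_bcontfun closed_AP_bcontfun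
        subspace_ergodic[OF assms] closed_ergodic[OF assms] small_decomposition[OF assms])
  then show "complete (PAP \<mu> :: (real \<Rightarrow>\<^sub>C 'a) set)"
    \<comment> \<open>In the complete ambient space of bounded continuous functions, closed sets are
      complete.\<close>
    by (simp add: complete_eq_closed)
qed

end
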